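(* Let $Q$ be a CC-loop and let $S\subseteq Q$ be a subset which associates, i.e. $x(yz)=(xy)z$ for all $x,y,z\in S$. Then the subloop $\langle S\rangle$ generated by $S$ associates, and is hence a group.
   Context: A loop is a set $Q$ with a binary operation having a two-sided identity $1$ such that all equations $xu=y$ and $vx=y$ have unique solutions $u,v$. A loop $Q$ is conjugacy closed (a CC-loop) if there are functions $f,g:Q\times Q\to Q$ such that for all $x,y,z\in Q$: $x(yz)=f(x,y)(xz)$ and $(zy)x=(zx)g(x,y)$. *)

theory Defs
  imports "HOL-Algebra.Group"
begin

text \<open>
  The record type of HOL-Algebra monoids serves as the signature (carrier, product, identity);
  associativity is not assumed.
\<close>

locale loop =
  fixes Q :: "('a, 'b) monoid_scheme" (structure)
  assumes m_closed: "\<lbrakk>x \<in> carrier Q; y \<in> carrier Q\<rbrakk> \<Longrightarrow> x \<otimes> y \<in> carrier Q"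
    and one_closed: "\<one> \<in> carrier Q"
    and l_one: "x \<in> carrier Q \<Longrightarrow> \<one> \<otimes> x = x"
    and r_one: "x \<in> carrier Q \<Longrightarrow> x \<otimes> \<one> = x"
    and r_solvable: "\<lbrakk>x \<in> carrier Q; y \<in> carrier Q\<rbrakk> \<Longrightarrow> \<exists>!u. u \<in> carrier Q \<and> x \<otimes> u = y"
    and l_solvable: "\<lbrakk>x \<in> carrier Q; y \<in> carrier Q\<rbrakk> \<Longrightarrow> \<exists>!v. v \<in> carrier Q \<and> v \<otimes> x = y"

locale cc_loop = loop +
  assumes conjugacy_closed:
    "\<exists>f \<in> carrier Q \<rightarrow> carrier Q \<rightarrow> carrier Q. \<exists>g \<in> carrier Q \<rightarrow> carrier Q \<rightarrow> carrier Q.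
       \<forall>x \<in> carrier Q. \<forall>y \<in> carrier Q. \<forall>z \<in> carrier Q.
         x \<otimes> (y \<otimes> z) = f x y \<otimes> (x \<otimes> z) \<and> (z \<otimes> y) \<otimes> x = (z \<otimes> x) \<otimes> g x y"

definition associates :: "('a, 'b) monoid_scheme \<Rightarrow> 'a set \<Rightarrow> bool" where
  "associates Q S \<longleftrightarrow> (\<forall>x \<in> S. \<forall>y \<in> S. \<forall>z \<in> S.
     x \<otimes>\<^bsub>Q\<^esub> (y \<otimes>\<^bsub>Q\<^esub> z) = (x \<otimes>\<^bsub>Q\<^esub> y) \<otimes>\<^bsub>Q\<^esub> z)"

text \<open>
  Keeping the identity of \<open>Q\<close> is no restriction: the identity \<open>e\<close> of a subset that is a loop
  under the induced product satisfies \<open>e \<otimes> e = e = e \<otimes> \<one>\<close>, hence \<open>e = \<one>\<close>.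
\<close>

definition subloop :: "'a set \<Rightarrow> ('a, 'b) monoid_scheme \<Rightarrow> bool" where
  "subloop H Q \<longleftrightarrow> H \<subseteq> carrier Q \<and> loop (Q\<lparr>carrier := H\<rparr>)"

definition generated_subloop :: "('a, 'b) monoid_scheme \<Rightarrow> 'a set \<Rightarrow> 'a set" where
  "generated_subloop Q S = \<Inter>{H. subloop H Q \<and> S \<subseteq> H}"

lemma (in loop) subloop_generated_subloop:
  assumes S: "S \<subseteq> carrier Q"
  shows "subloop (generated_subloop Q S) Q"
proof -
  let ?F = "{H. subloop H Q \<and> S \<subseteq> H}"
  have Q: "carrier Q \<in> ?F"
    using S by (simp add: subloop_def loop_axioms)
  have F: "H \<subseteq> carrier Q" "loop (Q\<lparr>carrier := H\<rparr>)" if "H \<in> ?F" for H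
    using that by (auto simp: subloop_def)
  have closed: "x \<otimes> y \<in> \<Inter>?F" if "x \<in> \<Inter>?F" "y \<in> \<Inter>?F" for x y
    using that loop.m_closed[OF F(2)] by fastforce
  have one: "\<one> \<in> \<Inter>?F"
    using loop.one_closed[OF F(2)] by fastforce
  have sub: "\<Inter>?F \<subseteq> carrier Q"
    using Q by blast
  have r: "\<exists>!u. u \<in> \<Inter>?F \<and> x \<otimes> u = y" if x: "x \<in> \<Inter>?F" and y: "y \<in> \<Inter>?F" for x y
  proof -
    have xy: "x \<in> carrier Q" "y \<in> carrier Q" using x y sub by auto
    obtain u where u: "u \<in> carrier Q" "x \<otimes> u = y" using r_solvable[OF xy] by blast
    have uniq: "v = u" if "v \<in> carrier Q" "x \<otimes> v = y" for v
      using r_solvable[OF xy] u that by blast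
    have "u \<in> H" if H: "H \<in> ?F" for H
    proof -
      have "x \<in> H" "y \<in> H" using x y H by auto
      then obtain v where "v \<in> H" "x \<otimes> v = y"
        using loop.r_solvable[OF F(2)[OF H], of x y] by auto
      then show ?thesis using uniq F(1)[OF H] by blast
    qed
    then show ?thesis using u uniq sub by blast
  qed
  have l: "\<exists>!u. u \<in> \<Inter>?F \<and> u \<otimes> x = y" if x: "x \<in> \<Inter>?F" and y: "y \<in> \<Inter>?F" for x y
  proof -
    have xy: "x \<in> carrier Q" "y \<in> carrier Q" using x y sub by auto
    obtain u where u: "u \<in> carrier Q" "u \<otimes> x = y" using l_solvable[OF xy] by blast
    have uniq: "v = u" if "v \<in> carrier Q" "v \<otimes> x = y" for v
      using l_solvable[OF xy] u that by blast
    have "u \<in> H" if H: "H \<in> ?F" for H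
    proof -
      have "x \<in> H" "y \<in> H" using x y H by auto
      then obtain v where "v \<in> H" "v \<otimes> x = y"
        using loop.l_solvable[OF F(2)[OF H], of x y] by auto
      then show ?thesis using uniq F(1)[OF H] by blast
    qed
    then show ?thesis using u uniq sub by blast
  qed
  have restrict: "carrier (Q\<lparr>carrier := H\<rparr>) = H" "mult (Q\<lparr>carrier := H\<rparr>) = mult Q"
      "one (Q\<lparr>carrier := H\<rparr>) = one Q" for H
    by simp_all
  have "loop (Q\<lparr>carrier := \<Inter>?F\<rparr>)"
  proof (rule loop.intro, unfold restrict)
    show "x \<otimes> y \<in> \<Inter>?F" if "x \<in> \<Inter>?F" "y \<in> \<Inter>?F" for x y by (rule closed[OF that])
    show "\<one> \<in> \<Inter>?F" by (rule one)
    show "\<one> \<otimes> x = x" if "x \<in> \<Inter>?F" for x using that sub l_one by blast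
    show "x \<otimes> \<one> = x" if "x \<in> \<Inter>?F" for x using that sub r_one by blast
    show "\<exists>!u. u \<in> \<Inter>?F \<and> x \<otimes> u = y" if "x \<in> \<Inter>?F" "y \<in> \<Inter>?F" for x y by (rule r[OF that])
    show "\<exists>!u. u \<in> \<Inter>?F \<and> u \<otimes> x = y" if "x \<in> \<Inter>?F" "y \<in> \<Inter>?F" for x y by (rule l[OF that])
  qed
  then show ?thesis
    using sub by (simp add: subloop_def generated_subloop_def)
qed

end

theory Submission
  imports Defs
begin

text \<open>
  In a CC-loop the triples \<open>(R\<^sub>x\<inverse> L\<^sub>x, L\<^sub>x, L\<^sub>x)\<close> and \<open>(R\<^sub>x, L\<^sub>x\<inverse> R\<^sub>x, R\<^sub>x)\<close> are autotopisms.
  A product of such triples with identical second and third components that fixes the identity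
  is an automorphism; this applies to the left inner maps \<open>L\<^bsub>xy\<^esub>\<inverse> L\<^sub>x L\<^sub>y\<close>, so the \<open>z\<close> that
  associate with given \<open>x, y\<close> (in this order) form a subloop.  Another product has third
  component the identity, which exhibits \<open>w\<close> as \<open>((x w) / x) n\<close> with \<open>n\<close> in the nucleus.  Since
  \<open>x, w, z\<close> associate iff \<open>(x w) / x, x, z\<close> do, association of a triple is invariant under
  permutations.  A generating set can then be replaced by the generated subloop in one coordinate
  after the other.
\<close>

section \<open>Divisions and autotopisms in a loop\<close>

context loop
begin

definition ldiv :: "'a \<Rightarrow> 'a \<Rightarrow> 'a" where
  "ldiv x y = (THE u. u \<in> carrier Q \<and> x \<otimes> u = y)"

definition rdiv :: "'a \<Rightarrow> 'a \<Rightarrow> 'a" where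
  "rdiv y x = (THE v. v \<in> carrier Q \<and> v \<otimes> x = y)"

lemma ldiv:
  assumes "x \<in> carrier Q" "y \<in> carrier Q"
  shows ldiv_closed: "ldiv x y \<in> carrier Q" and mult_ldiv: "x \<otimes> ldiv x y = y"
  using theI'[OF r_solvable[OF assms]] by (simp_all add: ldiv_def)

lemma rdiv:
  assumes "x \<in> carrier Q" "y \<in> carrier Q"
  shows rdiv_closed: "rdiv y x \<in> carrier Q" and rdiv_mult: "rdiv y x \<otimes> x = y"
  using theI'[OF l_solvable[OF assms]] by (simp_all add: rdiv_def)

lemma l_cancel:
  assumes "x \<otimes> u = x \<otimes> v" "x \<in> carrier Q" "u \<in> carrier Q" "v \<in> carrier Q"
  shows "u = v"
  using assms r_solvable[of x "x \<otimes> v"] m_closed by metis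

lemma r_cancel:
  assumes "u \<otimes> x = v \<otimes> x" "x \<in> carrier Q" "u \<in> carrier Q" "v \<in> carrier Q"
  shows "u = v"
  using assms l_solvable[of x "v \<otimes> x"] m_closed by metis

lemma ldiv_mult: "\<lbrakk>x \<in> carrier Q; y \<in> carrier Q\<rbrakk> \<Longrightarrow> ldiv x (x \<otimes> y) = y"
  using l_cancel ldiv m_closed by metis

lemma mult_rdiv: "\<lbrakk>x \<in> carrier Q; y \<in> carrier Q\<rbrakk> \<Longrightarrow> rdiv (y \<otimes> x) x = y"
  using r_cancel rdiv m_closed by metis

lemmas loop_simps = m_closed one_closed l_one r_one ldiv_closed mult_ldiv rdiv_closed rdiv_mult
  ldiv_mult mult_rdiv

text \<open>The maps are only asked to preserve the carrier; where inverse triples occur, their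
  components are supplied explicitly through \<open>autotopism_inverse\<close>.\<close>

definition autotopism :: "('a \<Rightarrow> 'a) \<Rightarrow> ('a \<Rightarrow> 'a) \<Rightarrow> ('a \<Rightarrow> 'a) \<Rightarrow> bool" where
  "autotopism \<alpha> \<beta> \<gamma> \<longleftrightarrow>
    \<alpha> \<in> carrier Q \<rightarrow> carrier Q \<and> \<beta> \<in> carrier Q \<rightarrow> carrier Q \<and> \<gamma> \<in> carrier Q \<rightarrow> carrier Q \<and>
    (\<forall>y \<in> carrier Q. \<forall>z \<in> carrier Q. \<alpha> y \<otimes> \<beta> z = \<gamma> (y \<otimes> z))"

lemma autotopism_comp:
  assumes "autotopism \<alpha> \<beta> \<gamma>" "autotopism \<alpha>' \<beta>' \<gamma>'"
  shows "autotopism (\<lambda>p. \<alpha> (\<alpha>' p)) (\<lambda>p. \<beta> (\<beta>' p)) (\<lambda>p. \<gamma> (\<gamma>' p))"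
  using assms unfolding autotopism_def by (auto simp: Pi_iff)

lemma autotopism_inverse:
  assumes "autotopism \<alpha> \<beta> \<gamma>"
    and "\<alpha>' \<in> carrier Q \<rightarrow> carrier Q" "\<beta>' \<in> carrier Q \<rightarrow> carrier Q" "\<gamma>' \<in> carrier Q \<rightarrow> carrier Q"
    and "\<And>p. p \<in> carrier Q \<Longrightarrow> \<alpha> (\<alpha>' p) = p" "\<And>p. p \<in> carrier Q \<Longrightarrow> \<beta> (\<beta>' p) = p"
      "\<And>p. p \<in> carrier Q \<Longrightarrow> \<gamma>' (\<gamma> p) = p"
  shows "autotopism \<alpha>' \<beta>' \<gamma>'"
proof -
  have "\<alpha>' y \<otimes> \<beta>' z = \<gamma>' (y \<otimes> z)" if "y \<in> carrier Q" "z \<in> carrier Q" for y z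
  proof -
    \<comment> \<open>The right inverses recover \<open>y\<close> and \<open>z\<close> on the
      left-hand side; the left inverse \<open>\<gamma>'\<close> then strips
      \<open>\<gamma>\<close>.\<close>
    have "\<alpha> (\<alpha>' y) \<otimes> \<beta> (\<beta>' z) = \<gamma> (\<alpha>' y \<otimes> \<beta>' z)"
      using assms(1-3) that m_closed unfolding autotopism_def by (auto simp: Pi_iff)
    then show ?thesis using assms that m_closed by (metis PiE)
  qed
  then show ?thesis using assms(2-4) by (simp add: autotopism_def)
qed

text \<open>Here \<alpha> inverts right multiplication by \<open>n\<close> and \<beta> is left
  multiplication by \<open>n\<close>, so the autotopism law at \<open>p \<otimes> n\<close>,
  \<open>q\<close> puts \<open>n\<close> in the middle nucleus.\<close>

lemma autotopism_third_id:
  assumes "autotopism \<alpha> \<beta> (\<lambda>p. p)"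
  defines "n \<equiv> \<beta> \<one>"
  shows "n \<in> carrier Q" "p \<in> carrier Q \<Longrightarrow> \<alpha> p \<otimes> n = p"
    "\<lbrakk>p \<in> carrier Q; q \<in> carrier Q\<rbrakk> \<Longrightarrow> p \<otimes> (n \<otimes> q) = (p \<otimes> n) \<otimes> q"
proof -
  show nC: "n \<in> carrier Q"
    using assms(1) n_def one_closed by (auto simp: autotopism_def)
  have T: "\<alpha> p \<otimes> \<beta> q = p \<otimes> q" if "p \<in> carrier Q" "q \<in> carrier Q" for p q
    using assms(1) that by (auto simp: autotopism_def)
  have clos: "\<alpha> p \<in> carrier Q" "\<beta> p \<in> carrier Q" if "p \<in> carrier Q" for p
    using assms(1) that by (auto simp: autotopism_def)
  show \<alpha>n: "\<alpha> p \<otimes> n = p" if "p \<in> carrier Q" for p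
    using T[OF that one_closed] that by (simp add: n_def r_one)
  have \<alpha>m: "\<alpha> (p \<otimes> n) = p" if p: "p \<in> carrier Q" for p
    using \<alpha>n[OF m_closed[OF p nC]] r_cancel p nC clos m_closed by blast
  have \<beta>: "\<beta> q = n \<otimes> q" if q: "q \<in> carrier Q" for q
    using T[OF nC q] \<alpha>m[OF one_closed] clos(2)[OF q] by (simp add: nC l_one)
  show "p \<otimes> (n \<otimes> q) = (p \<otimes> n) \<otimes> q" if "p \<in> carrier Q" "q \<in> carrier Q"
    using T[OF m_closed[OF that(1) nC] that(2)] \<alpha>m[OF that(1)] \<beta>[OF that(2)] by simp
qed

end

section \<open>Conjugation, autotopisms and inner maps of CC-loops\<close>

context cc_loop
begin

lemma left_conjugacy:
  assumes "x \<in> carrier Q" "y \<in> carrier Q" "z \<in> carrier Q"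
  shows "x \<otimes> (y \<otimes> z) = rdiv (x \<otimes> y) x \<otimes> (x \<otimes> z)"
proof -
  obtain f where f: "f \<in> carrier Q \<rightarrow> carrier Q \<rightarrow> carrier Q"
    and eq: "\<And>z. z \<in> carrier Q \<Longrightarrow> x \<otimes> (y \<otimes> z) = f x y \<otimes> (x \<otimes> z)"
    using conjugacy_closed assms by meson
  have "f x y \<in> carrier Q" using f assms by blast
  \<comment> \<open>The case \<open>z = \<one>\<close> determines \<open>f x y\<close>.\<close>
  moreover have "x \<otimes> y = f x y \<otimes> x" using eq[OF one_closed] assms by (simp add: r_one)
  ultimately show ?thesis using eq assms by (simp add: mult_rdiv)
qed

lemma right_conjugacy:
  assumes "x \<in> carrier Q" "y \<in> carrier Q" "z \<in> carrier Q"
  shows "(z \<otimes> y) \<otimes> x = (z \<otimes> x) \<otimes> ldiv x (y \<otimes> x)"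
proof -
  obtain g where g: "g \<in> carrier Q \<rightarrow> carrier Q \<rightarrow> carrier Q"
    and eq: "\<And>z. z \<in> carrier Q \<Longrightarrow> (z \<otimes> y) \<otimes> x = (z \<otimes> x) \<otimes> g x y"
    using conjugacy_closed assms by meson
  have "g x y \<in> carrier Q" using g assms by blast
  moreover have "y \<otimes> x = x \<otimes> g x y" using eq[OF one_closed] assms by (simp add: l_one)
  ultimately show ?thesis using eq assms by (simp add: ldiv_mult)
qed

lemma autotopism_left:
  "x \<in> carrier Q \<Longrightarrow> autotopism (\<lambda>p. rdiv (x \<otimes> p) x) ((\<otimes>) x) ((\<otimes>) x)"
  by (simp add: autotopism_def Pi_iff loop_simps left_conjugacy)

lemma autotopism_right:
  "x \<in> carrier Q \<Longrightarrow> autotopism (\<lambda>p. p \<otimes> x) (\<lambda>p. ldiv x (p \<otimes> x)) (\<lambda>p. p \<otimes> x)"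
  by (simp add: autotopism_def Pi_iff loop_simps right_conjugacy)

lemma autotopism_left_inverse:
  assumes "x \<in> carrier Q"
  shows "autotopism (\<lambda>p. ldiv x (p \<otimes> x)) (ldiv x) (ldiv x)"
  by (rule autotopism_inverse[OF autotopism_left[OF assms]]) (simp_all add: assms loop_simps Pi_iff)

lemma autotopism_right_inverse:
  assumes "x \<in> carrier Q"
  shows "autotopism (\<lambda>p. rdiv p x) (\<lambda>p. rdiv (x \<otimes> p) x) (\<lambda>p. rdiv p x)"
  by (rule autotopism_inverse[OF autotopism_right[OF assms]]) (simp_all add: assms loop_simps Pi_iff)

lemma left_inner_hom:
  assumes x: "x \<in> carrier Q" and y: "y \<in> carrier Q"
  defines "\<phi> \<equiv> \<lambda>z. ldiv (x \<otimes> y) (x \<otimes> (y \<otimes> z))"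
  assumes p: "p \<in> carrier Q" and q: "q \<in> carrier Q"
  shows "\<phi> (p \<otimes> q) = \<phi> p \<otimes> \<phi> q"
proof -
  obtain \<alpha> where \<alpha>: "autotopism \<alpha> \<phi> \<phi>"
    unfolding \<phi>_def
    using autotopism_comp[OF autotopism_left_inverse[OF m_closed[OF x y]]
        autotopism_comp[OF autotopism_left[OF x] autotopism_left[OF y]]] by blast
  have "\<phi> \<one> = \<one>" unfolding \<phi>_def
    using x y ldiv_mult[OF m_closed[OF x y] one_closed] by (simp add: loop_simps)
  \<comment> \<open>As \<open>\<phi> \<one> = \<one>\<close>, the second argument
    \<open>\<one>\<close> forces \<alpha> to agree with \<phi>.\<close>
  moreover have "\<alpha> p \<otimes> \<phi> \<one> = \<phi> (p \<otimes> \<one>)" "\<alpha> p \<in> carrier Q" "\<alpha> p \<otimes> \<phi> q = \<phi> (p \<otimes> q)"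
    using \<alpha> p q one_closed by (auto simp: autotopism_def)
  ultimately show ?thesis using p by (simp add: r_one)
qed

lemma subloop_associating:
  assumes x: "x \<in> carrier Q" and y: "y \<in> carrier Q"
  shows "subloop {z \<in> carrier Q. x \<otimes> (y \<otimes> z) = (x \<otimes> y) \<otimes> z} Q"
proof -
  define \<phi> where "\<phi> = (\<lambda>z. ldiv (x \<otimes> y) (x \<otimes> (y \<otimes> z)))"
  have fix_iff: "x \<otimes> (y \<otimes> z) = (x \<otimes> y) \<otimes> z \<longleftrightarrow> \<phi> z = z" if "z \<in> carrier Q" for z
    unfolding \<phi>_def using that x y by (metis ldiv_mult mult_ldiv m_closed)
  define H where "H = {z \<in> carrier Q. \<phi> z = z}"
  have H_eq: "{z \<in> carrier Q. x \<otimes> (y \<otimes> z) = (x \<otimes> y) \<otimes> z} = H"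
    using fix_iff by (auto simp: H_def)
  have \<phi>C: "\<phi> z \<in> carrier Q" if "z \<in> carrier Q" for z
    using that x y by (simp add: \<phi>_def loop_simps)
  have hom: "\<phi> (p \<otimes> q) = \<phi> p \<otimes> \<phi> q" if "p \<in> carrier Q" "q \<in> carrier Q" for p q
    unfolding \<phi>_def using left_inner_hom[OF x y that] .
  have sub: "z \<in> carrier Q" if "z \<in> H" for z
    using that by (simp add: H_def)
  have one: "\<one> \<in> H" using fix_iff[OF one_closed] x y by (simp add: H_def loop_simps)
  have closed: "a \<otimes> b \<in> H" if "a \<in> H" "b \<in> H" for a b
    using that hom by (auto simp: H_def m_closed)
  \<comment> \<open>Fixed points are closed under division: \<open>a \<otimes> \<phi> u = \<phi> (a
    \<otimes> u) = a \<otimes> u\<close>, and \<open>a\<close> cancels.\<close>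
  have r: "u \<in> H" if "a \<in> H" "a \<otimes> u \<in> H" "u \<in> carrier Q" for a u
    using that hom[of a u] l_cancel[of a "\<phi> u" u] \<phi>C by (simp add: H_def)
  have l: "u \<in> H" if "a \<in> H" "u \<otimes> a \<in> H" "u \<in> carrier Q" for a u
    using that hom[of u a] r_cancel[of "\<phi> u" a u] \<phi>C by (simp add: H_def)
  have "\<exists>!u. u \<in> H \<and> a \<otimes> u = b" if "a \<in> H" "b \<in> H" for a b
    using r_solvable[OF sub[OF that(1)] sub[OF that(2)]] r[OF that(1)] that(2) sub by metis
  moreover have "\<exists>!v. v \<in> H \<and> v \<otimes> a = b" if "a \<in> H" "b \<in> H" for a b
    using l_solvable[OF sub[OF that(1)] sub[OF that(2)]] l[OF that(1)] that(2) sub by metis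
  ultimately have "loop (Q\<lparr>carrier := H\<rparr>)"
    by unfold_locales (simp_all add: one closed sub l_one r_one)
  then show ?thesis using sub by (auto simp: subloop_def H_eq)
qed

text \<open>
  The autotopism \<open>A\<^sub>x B\<^sub>y A\<^sub>x\<inverse> B\<^sub>x B\<^sub>w\<inverse>\<close> with \<open>w = x y\<close>, where \<open>A\<close> and \<open>B\<close> are the two families of
  autotopisms, has third component the identity and first component \<open>R\<^sub>x\<inverse> R\<^sub>w R\<^sub>x R\<^sub>w\<inverse>\<close>.
\<close>

lemma conjugate_middle_nuclear:
  assumes x: "x \<in> carrier Q" and w: "w \<in> carrier Q"
  obtains n where "n \<in> carrier Q" "rdiv (x \<otimes> w) x \<otimes> n = w"
    "\<And>p q. \<lbrakk>p \<in> carrier Q; q \<in> carrier Q\<rbrakk> \<Longrightarrow> p \<otimes> (n \<otimes> q) = (p \<otimes> n) \<otimes> q"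
proof -
  define y where "y = ldiv x w"
  have y: "y \<in> carrier Q" and xy: "x \<otimes> y = w"
    using x w by (simp_all add: y_def loop_simps)
  \<comment> \<open>The part \<open>L_x R_y L_x^-1\<close> of the third component is
    \<open>R_w R_x^-1\<close>, which the remaining factors \<open>R_x R_w^-1\<close> cancel.\<close>
  have shift: "x \<otimes> (ldiv x p \<otimes> y) = rdiv p x \<otimes> w" if "p \<in> carrier Q" for p
    using left_conjugacy[OF x ldiv_closed[OF x that] y] that x by (simp add: xy loop_simps)
  define \<alpha> where
    "\<alpha> = (\<lambda>p. rdiv (x \<otimes> (ldiv x ((rdiv p w \<otimes> x) \<otimes> x) \<otimes> y)) x)"
  obtain \<beta> where "autotopism \<alpha> \<beta> (\<lambda>p. x \<otimes> (ldiv x (rdiv p w \<otimes> x) \<otimes> y))"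
    unfolding \<alpha>_def
    using autotopism_comp[OF autotopism_left[OF x] autotopism_comp[OF autotopism_right[OF y]
      autotopism_comp[OF autotopism_left_inverse[OF x] autotopism_comp[OF autotopism_right[OF x]
      autotopism_right_inverse[OF w]]]]] by blast
  moreover have "x \<otimes> (ldiv x (rdiv p w \<otimes> x) \<otimes> y) = p" if "p \<in> carrier Q" for p
    using that x w by (simp add: shift loop_simps)
  ultimately have T: "autotopism \<alpha> \<beta> (\<lambda>p. p)"
    by (auto simp: autotopism_def m_closed)
  \<comment> \<open>Evaluated at \<open>w\<close>, the first component is the conjugate
    \<open>rdiv (x \<otimes> w) x\<close>, so \<open>\<alpha> w \<otimes> n = w\<close> is the
    desired factorization.\<close>
  have "rdiv w w = \<one>" using w mult_rdiv[OF w one_closed] by (simp add: l_one)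
  then have "\<alpha> w = rdiv (x \<otimes> w) x"
    using x w by (simp add: \<alpha>_def xy loop_simps)
  with that[of "\<beta> \<one>"] autotopism_third_id[OF T] w show thesis
    by force
qed

section \<open>Nuclear elements and permutations of associating triples\<close>

lemma middle_nuclear_imp_left:
  assumes n: "n \<in> carrier Q"
    and mid: "\<And>p q. \<lbrakk>p \<in> carrier Q; q \<in> carrier Q\<rbrakk> \<Longrightarrow> p \<otimes> (n \<otimes> q) = (p \<otimes> n) \<otimes> q"
    and "a \<in> carrier Q" "b \<in> carrier Q"
  shows "n \<otimes> (a \<otimes> b) = (n \<otimes> a) \<otimes> b"
  \<comment> \<open>The CC law gives \<open>n(ab) = ((na)/n)(nb)\<close>; middle nuclearity moves
    this \<open>n\<close> next to the quotient, where it cancels.\<close>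
  using left_conjugacy[OF n assms(3,4)] mid assms(1,3,4) by (simp add: loop_simps)

text \<open>This allows a nuclear factor to be moved from the right of \<open>u\<close> to its left:
  \<open>u \<otimes> n = m \<otimes> u\<close>.\<close>

lemma left_nuclear_conjugate:
  assumes n: "n \<in> carrier Q"
    and left: "\<And>a b. \<lbrakk>a \<in> carrier Q; b \<in> carrier Q\<rbrakk> \<Longrightarrow> n \<otimes> (a \<otimes> b) = (n \<otimes> a) \<otimes> b"
    and u: "u \<in> carrier Q" and a: "a \<in> carrier Q" and b: "b \<in> carrier Q"
  defines "m \<equiv> rdiv (u \<otimes> n) u"
  shows "m \<otimes> (a \<otimes> b) = (m \<otimes> a) \<otimes> b"
proof -
  \<comment> \<open>Chosen so that \<open>rdiv (u \<otimes> c) u = a\<close>. In \<open>key\<close>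
    the factor before \<open>b\<close> is independent of \<open>b\<close>, and
    \<open>b = \<one>\<close> identifies it as \<open>m \<otimes> a\<close>.\<close>
  define c where "c = ldiv u (a \<otimes> u)"
  have c: "c \<in> carrier Q" using u a by (simp add: c_def loop_simps)
  have key: "m \<otimes> (a \<otimes> b) = rdiv (u \<otimes> (n \<otimes> c)) u \<otimes> b" if b: "b \<in> carrier Q" for b
  proof -
    have d: "ldiv u b \<in> carrier Q" using u b by (simp add: loop_simps)
    have "u \<otimes> (c \<otimes> ldiv u b) = a \<otimes> b"
      using left_conjugacy[OF u c d] u a b by (simp add: c_def loop_simps)
    then have "m \<otimes> (a \<otimes> b) = u \<otimes> (n \<otimes> (c \<otimes> ldiv u b))"
      using left_conjugacy[OF u n m_closed[OF c d]] by (simp add: m_def)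
    also have "\<dots> = u \<otimes> ((n \<otimes> c) \<otimes> ldiv u b)" using left[OF c d] by simp
    also have "\<dots> = rdiv (u \<otimes> (n \<otimes> c)) u \<otimes> b"
      using left_conjugacy[OF u m_closed[OF n c] d] u b by (simp add: loop_simps)
    finally show ?thesis .
  qed
  have "m \<otimes> a = rdiv (u \<otimes> (n \<otimes> c)) u"
    using key[OF one_closed] u n c a by (simp add: loop_simps)
  then show ?thesis using key[OF b] by simp
qed

text \<open>By the CC law, association of \<open>x, y, z\<close> passes to \<open>u, x, z\<close>
  with \<open>u\<close> the conjugate of \<open>y\<close>. Since \<open>y = m \<otimes> u\<close>
  with \<open>m\<close> left nuclear, it passes on to \<open>y, x, z\<close>.\<close>

lemma assoc_swap_left:
  assumes x: "x \<in> carrier Q" and y: "y \<in> carrier Q" and z: "z \<in> carrier Q"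
    and xyz: "x \<otimes> (y \<otimes> z) = (x \<otimes> y) \<otimes> z"
  shows "y \<otimes> (x \<otimes> z) = (y \<otimes> x) \<otimes> z"
proof -
  define u where "u = rdiv (x \<otimes> y) x"
  have u: "u \<in> carrier Q" and ux: "u \<otimes> x = x \<otimes> y"
    using x y by (simp_all add: u_def loop_simps)
  have uxz: "u \<otimes> (x \<otimes> z) = (u \<otimes> x) \<otimes> z"
    using left_conjugacy[OF x y z] xyz ux by (simp add: u_def)
  obtain n where n: "n \<in> carrier Q" "u \<otimes> n = y"
    and mid: "\<And>p q. \<lbrakk>p \<in> carrier Q; q \<in> carrier Q\<rbrakk> \<Longrightarrow> p \<otimes> (n \<otimes> q) = (p \<otimes> n) \<otimes> q"
    using conjugate_middle_nuclear[OF x y] unfolding u_def by blast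
  define m where "m = rdiv (u \<otimes> n) u"
  have m: "m \<in> carrier Q" and mu: "m \<otimes> u = y"
    using u n y by (simp_all add: m_def loop_simps)
  have left: "m \<otimes> (a \<otimes> b) = (m \<otimes> a) \<otimes> b" if "a \<in> carrier Q" "b \<in> carrier Q" for a b
    unfolding m_def
    using left_nuclear_conjugate[OF n(1) middle_nuclear_imp_left[OF n(1) mid] u that] by simp
  have "y \<otimes> (x \<otimes> z) = m \<otimes> (u \<otimes> (x \<otimes> z))"
    using left[of u "x \<otimes> z"] u x z mu by (simp add: m_closed)
  also have "\<dots> = m \<otimes> ((u \<otimes> x) \<otimes> z)" using uxz by simp
  also have "\<dots> = (m \<otimes> (u \<otimes> x)) \<otimes> z" using left u x z by (simp add: m_closed)
  also have "\<dots> = (y \<otimes> x) \<otimes> z" using left[OF u x] mu by simp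
  finally show ?thesis .
qed

text \<open>Reversing the product exchanges the two halves of the CC law, hence \<open>f\<close> and
  \<open>g\<close>. Mirror images of proved facts follow.\<close>

lemma cc_loop_opposite: "cc_loop (Q\<lparr>mult := \<lambda>a b. b \<otimes> a\<rparr>)"
proof -
  obtain f g where fg: "f \<in> carrier Q \<rightarrow> carrier Q \<rightarrow> carrier Q" "g \<in> carrier Q \<rightarrow> carrier Q \<rightarrow> carrier Q"
    "\<forall>x \<in> carrier Q. \<forall>y \<in> carrier Q. \<forall>z \<in> carrier Q.
         x \<otimes> (y \<otimes> z) = f x y \<otimes> (x \<otimes> z) \<and> (z \<otimes> y) \<otimes> x = (z \<otimes> x) \<otimes> g x y"
    using conjugacy_closed by blast
  show ?thesis
    apply unfold_locales
          apply (simp_all add: m_closed one_closed l_one r_one l_solvable r_solvable)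
    apply (rule bexI[OF _ fg(2)], rule bexI[OF _ fg(1)])
    using fg(3) by blast
qed

lemma assoc_swap_right:
  assumes "x \<in> carrier Q" "y \<in> carrier Q" "z \<in> carrier Q"
    and "x \<otimes> (y \<otimes> z) = (x \<otimes> y) \<otimes> z"
  shows "x \<otimes> (z \<otimes> y) = (x \<otimes> z) \<otimes> y"
  using cc_loop.assoc_swap_left[OF cc_loop_opposite, of z y x] assms by simp

lemma assoc_rotate:
  assumes "x \<in> carrier Q" "y \<in> carrier Q" "z \<in> carrier Q"
    and "x \<otimes> (y \<otimes> z) = (x \<otimes> y) \<otimes> z"
  shows "z \<otimes> (x \<otimes> y) = (z \<otimes> x) \<otimes> y"
  using assoc_swap_left[OF assms(1,3,2) assoc_swap_right[OF assms]] .

section \<open>Passage to the generated subloop\<close>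

lemma assoc_generated_subloop:
  assumes "x \<in> carrier Q" "y \<in> carrier Q" "S \<subseteq> carrier Q"
    and "\<And>s. s \<in> S \<Longrightarrow> x \<otimes> (y \<otimes> s) = (x \<otimes> y) \<otimes> s"
    and "z \<in> generated_subloop Q S"
  shows "x \<otimes> (y \<otimes> z) = (x \<otimes> y) \<otimes> z"
  \<comment> \<open>The subloop of all elements associating with \<open>x, y\<close> contains
    \<open>S\<close>, so it is one of the sets intersected.\<close>
  using assms subloop_associating[OF assms(1,2)] by (auto simp: generated_subloop_def)

lemma associates_generated_subloop:
  assumes S: "S \<subseteq> carrier Q" and assoc: "associates Q S"
  shows "associates Q (generated_subloop Q S)"
proof -
  let ?G = "generated_subloop Q S"
  have G: "z \<in> carrier Q" if "z \<in> ?G" for z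
    using subloop_generated_subloop[OF S] that by (auto simp: subloop_def)
  have C: "s \<in> carrier Q" if "s \<in> S" for s using S that by blast
  have 1: "x \<otimes> (y \<otimes> z) = (x \<otimes> y) \<otimes> z" if "x \<in> S" "y \<in> S" "z \<in> ?G" for x y z
    using assoc_generated_subloop[OF C[OF that(1)] C[OF that(2)] S _ that(3)] assoc that
    by (simp add: associates_def)
  \<comment> \<open>Only the last coordinate can be enlarged directly. Rotating \<open>1\<close>
    puts its enlarged coordinate first and leaves one from \<open>S\<close> last; the next step
    rotates \<open>2\<close> likewise.\<close>
  have 2: "x \<otimes> (y \<otimes> z) = (x \<otimes> y) \<otimes> z" if "x \<in> ?G" "y \<in> S" "z \<in> ?G" for x y z
    using assoc_generated_subloop[OF G[OF that(1)] C[OF that(2)] S _ that(3)]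
      assoc_rotate[OF C C G 1] that by blast
  have "x \<otimes> (y \<otimes> z) = (x \<otimes> y) \<otimes> z" if "x \<in> ?G" "y \<in> ?G" "z \<in> ?G" for x y z
    using assoc_generated_subloop[OF G[OF that(1)] G[OF that(2)] S _ that(3)]
      assoc_rotate[OF G C G 2] that by blast
  then show ?thesis by (simp add: associates_def)
qed

end

lemma (in loop) group_if_associates:
  assumes "associates Q (carrier Q)"
  shows "group Q"
proof (rule groupI)
  show "\<exists>y\<in>carrier Q. y \<otimes> x = \<one>" if "x \<in> carrier Q" for x
    using l_solvable[OF that one_closed] by blast
  show "x \<otimes> y \<otimes> z = x \<otimes> (y \<otimes> z)" if "x \<in> carrier Q" "y \<in> carrier Q" "z \<in> carrier Q" for x y z
    using assms that by (simp add: associates_def)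
qed (simp_all add: m_closed one_closed l_one)

theorem corollary5p4:
  fixes Q :: "('a, 'b) monoid_scheme" and S :: "'a set"
  assumes "cc_loop Q"
    and "S \<subseteq> carrier Q"
    and "associates Q S"
  shows "associates Q (generated_subloop Q S)
    \<and> group (Q\<lparr>carrier := generated_subloop Q S\<rparr>)"
proof -
  interpret cc_loop Q by fact
  have assoc: "associates Q (generated_subloop Q S)"
    using associates_generated_subloop assms(2,3) .
  moreover have "loop (Q\<lparr>carrier := generated_subloop Q S\<rparr>)"
    using subloop_generated_subloop[OF assms(2)] by (simp add: subloop_def)
  ultimately show ?thesis
    using loop.group_if_associates[of "Q\<lparr>carrier := generated_subloop Q S\<rparr>"]
    by (simp add: associates_def)
qed

end
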